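(* Let $J,M\ge1$ be integers, $0\le p<1$, and $q_j\ge0$, $\eta_j>1$ for $j=1,\dots,J$. Let $\{R^{(k)}\}_{k\ge1}$ be a sequence of non-negative reals satisfying $$R^{(k+1)}\le p\,R^{(k)}+\sum_{j=1}^J q_j\max_{\max\{1,k-M+1\}\le k'\le k}(R^{(k')})^{\eta_j}\qquad\text{for all }k\ge1.$$ If, for some $\delta$ with $p\le\delta<1$, $$p+\sum_{j=1}^J q_j (R^{(1)})^{\eta_j-1}\le\delta<1,$$ then: (a) $R^{(k)}\le\delta^{\lceil (k-1)/M\rceil}R^{(1)}$ for all $k\ge1$; (b) there exists a sequence $\{\bar R^{(k)}\}_{k\ge1}$ with $\bar R^{(k)}\ge R^{(k)}$ for all $k\ge1$ and $\bar R^{(1)}=R^{(1)}$ such that $\lim_{k\to\infty}\bar R^{(k+1)}/\bar R^{(k)}=p$. *)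

theory Defs
  imports Complex_Main
begin

end

theory Submission
  imports Defs
begin

text \<open>
  At the index m where R is largest on the window, every term R(m)^(\<eta> j) factors as
  R(m) * R(m)^(\<eta> j - 1), so R(k+1) \<le> p R(k) + S(R(m)) R(m) with S(x) = \<Sum>j. q j x^(\<eta> j - 1)
  increasing in x. Since S(R(1)) \<le> \<delta> - p, strong induction gives (a), and so R tends to 0 and
  S(R(m)) becomes arbitrarily small. Hence R(k) = O(c^k) for every c > p.
  For a sequence c n decreasing to p and constants C n large enough, g(k) = inf over n of
  C n * (c n)^k is a positive log-concave majorant of R. Its ratios decrease, and their limit
  lies between p and every c n. Resetting g at k = 1 gives (b).
\<close>

text \<open>Log-concavity makes the ratios \<open>g (k + 1) / g k\<close> decrease, and
  \<open>low\<close> keeps them above \<open>p\<close>, so they have a limit \<open>L\<close>. If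
  \<open>L > p\<close>, some \<open>c n\<close> lies below \<open>L\<close>; then \<open>g\<close>
  grows at least like \<open>L ^ k\<close>, which outgrows the bound
  \<open>C n * c n ^ k\<close>.\<close>

lemma log_concave_majorant_limit:
  fixes g c C :: "nat \<Rightarrow> real" and p :: real
  assumes pos: "\<And>k. g k > 0"
    and conc: "\<And>k. g k * g (k + 2) \<le> g (k + 1) ^ 2"
    and low: "\<And>k. p * g k \<le> g (k + 1)"
    and up: "\<And>n k. g k \<le> C n * c n ^ k"
    and c: "c \<longlonglongrightarrow> p" and cpos: "\<And>n. c n > 0"
  shows "(\<lambda>k. g (k + 1) / g k) \<longlonglongrightarrow> p"
proof -
  define r where "r = (\<lambda>k. g (k + 1) / g k)"
  have "decseq r"
  proof (rule decseq_SucI)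
    fix k
    show "r (Suc k) \<le> r k"
      using conc[of k] pos[of k] pos[of "Suc k"]
      by (simp add: r_def field_simps power2_eq_square)
  qed
  moreover have rp: "p \<le> r k" for k
    using low[of k] pos[of k] by (simp add: r_def field_simps)
  ultimately obtain L where L: "r \<longlonglongrightarrow> L" and Lr: "\<And>k. L \<le> r k"
    using decseq_convergent[of r p] by metis
  have "p \<le> L" using LIMSEQ_le_const[OF L] rp by blast
  moreover have "L \<le> p"
  proof (rule ccontr)
    assume "\<not> L \<le> p"
    then obtain n where n: "c n < L"
      using order_tendstoD(2)[OF c, of L] by (auto simp: eventually_sequentially)
    then have L0: "L > 0" using cpos[of n] by linarith
    have geo: "g 0 * L ^ k \<le> g k" for k
    proof (induction k)
      case (Suc k)
      have "g 0 * L ^ Suc k \<le> L * g k"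
        using mult_left_mono[OF Suc, of L] L0 by (simp add: mult_ac)
      also have "\<dots> \<le> g (Suc k)"
        using Lr[of k] pos[of k] by (simp add: r_def field_simps)
      finally show ?case .
    qed simp
    have bnd: "(L / c n) ^ k \<le> C n / g 0" for k
    proof -
      have "g 0 * L ^ k \<le> C n * c n ^ k" using geo[of k] up[of k n] by linarith
      then show ?thesis using pos[of 0] cpos[of n]
        by (simp add: field_simps power_divide)
    qed
    obtain k where "C n / g 0 < (L / c n) ^ k"
      using real_arch_pow[of "L / c n" "C n / g 0"] n cpos[of n] by auto
    with bnd[of k] show False by linarith
  qed
  ultimately show ?thesis using L by (simp add: r_def)
qed

text \<open>A geometric sequence is log-affine in \<open>k\<close>, so an infimum of such sequences
  is log-concave. Strict positivity of \<open>g\<close>, even where \<open>R\<close> vanishes, makes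
  its ratios meaningful.\<close>

lemma ratio_limit_majorant:
  fixes R :: "nat \<Rightarrow> real" and p :: real
  assumes p: "0 \<le> p" "p < 1"
    and geo: "\<And>c. p < c \<Longrightarrow> c < 1 \<Longrightarrow> \<exists>C. \<forall>k\<ge>1. R k \<le> C * c ^ k"
  shows "\<exists>g. (\<forall>k. g k > 0) \<and> (\<forall>k\<ge>1. R k \<le> g k) \<and> (\<lambda>k. g (k + 1) / g k) \<longlonglongrightarrow> p"
proof -
  \<comment> \<open>The shift by 2 puts \<open>c n\<close> strictly below 1 already at
    \<open>n = 0\<close>.\<close>
  define c where "c = (\<lambda>n. p + (1 - p) / (real n + 2))"
  have cp: "p < c n" for n using p by (simp add: c_def)
  have c1: "c n < 1" for n
  proof -
    have "(1 - p) / (real n + 2) < (1 - p) / 1"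
      using p by (intro divide_strict_left_mono) auto
    then show ?thesis by (simp add: c_def)
  qed
  have c0: "c n > 0" for n using cp[of n] p by linarith
  have "(\<lambda>n. (1 - p) / real (n + 2)) \<longlonglongrightarrow> 0"
    by (rule LIMSEQ_ignore_initial_segment[OF lim_const_over_n])
  from tendsto_add[OF tendsto_const[of p] this] have clim: "c \<longlonglongrightarrow> p"
    by (simp add: c_def add_ac)
  have "\<forall>n. \<exists>C. \<forall>k\<ge>1. R k \<le> C * c n ^ k"
    using geo cp c1 by blast
  then obtain B where B: "\<And>n k. k \<ge> 1 \<Longrightarrow> R k \<le> B n * c n ^ k" by metis
  \<comment> \<open>The lower bound \<open>1 / c n ^ n\<close> keeps the infimum over n positive, also when \<open>p = 0\<close>.\<close>
  define C where "C = (\<lambda>n. max (B n) (1 / c n ^ n))"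
  define g where "g = (\<lambda>k. INF n. C n * c n ^ k)"
  have C0: "C n > 0" for n using c0[of n] by (auto simp: C_def less_max_iff_disj)
  have bdd: "bdd_below (range (\<lambda>n. C n * c n ^ k))" for k
    by (rule bdd_belowI[of _ 0]) (use C0 c0 in \<open>auto intro!: mult_nonneg_nonneg less_imp_le\<close>)
  have up: "g k \<le> C n * c n ^ k" for n k
    unfolding g_def by (rule cINF_lower[OF bdd]) simp
  have lowI: "x \<le> g k" if "\<And>n. x \<le> C n * c n ^ k" for x k
    unfolding g_def by (rule cINF_greatest) (use that in auto)
  have gpos: "g k > 0" for k
  proof -
    \<comment> \<open>For \<open>n \<ge> k\<close> the terms of the infimum are at least 1, so only
      finitely many positive terms can be smaller.\<close>
    define x where "x = Min (insert 1 ((\<lambda>n. C n * c n ^ k) ` {..<k}))"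
    have "0 < x" using C0 c0 by (auto simp: x_def)
    moreover have "x \<le> g k"
    proof (rule lowI)
      fix n
      show "x \<le> C n * c n ^ k"
      proof (cases "n < k")
        case True
        then show ?thesis unfolding x_def by (intro Min_le) auto
      next
        case False
        have "x \<le> 1" unfolding x_def by (intro Min_le) auto
        also have "1 \<le> c n ^ k / c n ^ n"
          using power_decreasing[of k n "c n"] False c0[of n] c1[of n] by simp
        also have "\<dots> \<le> C n * c n ^ k"
          using mult_right_mono[of "1 / c n ^ n" "C n" "c n ^ k"] c0[of n] by (simp add: C_def)
        finally show ?thesis .
      qed
    qed
    ultimately show ?thesis by linarith
  qed
  have conc: "g k * g (k + 2) \<le> g (k + 1) ^ 2" for k
  proof -
    \<comment> \<open>Each \<open>C n * c n ^ (k + 1)\<close> is the geometric mean of its two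
      neighbours. Taking the root first turns the claim into a lower bound for the infimum
      \<open>g (k + 1)\<close>.\<close>
    have "sqrt (g k * g (k + 2)) \<le> g (k + 1)"
    proof (rule lowI)
      fix n
      have "g k * g (k + 2) \<le> (C n * c n ^ k) * (C n * c n ^ (k + 2))"
        using gpos C0 c0 by (intro mult_mono up) (auto intro: less_imp_le)
      also have "\<dots> = (C n * c n ^ (k + 1)) ^ 2"
        by (simp add: power2_eq_square)
      finally show "sqrt (g k * g (k + 2)) \<le> C n * c n ^ (k + 1)"
        using C0[of n] c0[of n] by (intro real_le_lsqrt) (auto intro: less_imp_le)
    qed
    then show ?thesis by (rule sqrt_le_D)
  qed
  have low: "p * g k \<le> g (k + 1)" for k
  proof (rule lowI)
    fix n
    have "p * g k \<le> c n * (C n * c n ^ k)"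
      using up[of k n] cp[of n] gpos[of k] c0[of n] by (intro mult_mono) (auto intro: less_imp_le)
    then show "p * g k \<le> C n * c n ^ (k + 1)" by (simp add: mult_ac)
  qed
  have maj: "R k \<le> g k" if "k \<ge> 1" for k
  proof (rule lowI)
    fix n
    have "B n * c n ^ k \<le> C n * c n ^ k"
      using c0[of n] by (intro mult_right_mono) (auto simp: C_def)
    then show "R k \<le> C n * c n ^ k" using B[OF that, of n] by linarith
  qed
  show ?thesis
    using gpos maj log_concave_majorant_limit[OF gpos conc low up clim c0] by blast
qed

text \<open>In the induction, \<open>p * R l\<close> costs at most \<open>p * C * c ^ l\<close>, and
  the remaining \<open>(c - p) * C * c ^ l\<close> must absorb \<open>S m * R m\<close>. This works
  once \<open>S m < (c - p) * c ^ M\<close>, the factor \<open>c ^ M\<close> compensating for the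
  lag from \<open>m\<close> to \<open>l\<close>.\<close>

lemma window_recursion_geometric:
  fixes R S :: "nat \<Rightarrow> real" and p c :: real and M :: nat
  assumes p: "0 \<le> p" "p < c" and c1: "c < 1" and nonneg: "\<And>k. k \<ge> 1 \<Longrightarrow> R k \<ge> 0"
    and rec: "\<And>k. k \<ge> 1 \<Longrightarrow> \<exists>m\<in>{max 1 (k + 1 - M)..k}. R (k + 1) \<le> p * R k + S m * R m"
    and S: "S \<longlonglongrightarrow> 0"
  shows "\<exists>C. \<forall>k\<ge>1. R k \<le> C * c ^ k"
proof -
  have c0: "c > 0" using p by linarith
  define e where "e = (c - p) * c ^ M"
  have e0: "e > 0" using p c0 by (simp add: e_def)
  obtain N where N: "\<And>m. m \<ge> N \<Longrightarrow> S m < e"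
    using order_tendstoD(2)[OF S e0] by (auto simp: eventually_sequentially)
  \<comment> \<open>The bound holds by choice of \<open>C\<close> up to \<open>N + M + 1\<close>;
    past this index the whole window lies at or beyond \<open>N\<close>.\<close>
  define C where "C = Max (insert 0 ((\<lambda>k. R k / c ^ k) ` {..N + M + 1}))"
  have C0: "C \<ge> 0" unfolding C_def by (intro Max_ge) auto
  have "R k \<le> C * c ^ k" if "k \<ge> 1" for k
    using that
  proof (induction k rule: less_induct)
    case (less k)
    show ?case
    proof (cases "k \<le> N + M + 1")
      case True
      then have "R k / c ^ k \<le> C" unfolding C_def by (intro Max_ge) auto
      then show ?thesis using c0 by (simp add: field_simps)
    next
      case False
      then obtain l where l: "k = l + 1" "l \<ge> 1" by (cases k) auto
      obtain m where m: "m \<in> {max 1 (l + 1 - M)..l}" "R (l + 1) \<le> p * R l + S m * R m"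
        using rec[of l] l by auto
      have mN: "m \<ge> N" "m \<ge> 1" "m \<le> l" "l \<le> M + m" using m(1) False l by auto
      have Rl: "R l \<le> C * c ^ l" and Rm: "R m \<le> C * c ^ m"
        using less.IH[of l] less.IH[of m] mN l by auto
      have "S m * R m \<le> e * R m"
        using N[of m] mN nonneg[of m] by (intro mult_right_mono) auto
      also have "\<dots> \<le> e * (C * c ^ m)" using Rm e0 by (intro mult_left_mono) auto
      also have "\<dots> = (c - p) * C * c ^ (M + m)" by (simp add: e_def power_add)
      also have "\<dots> \<le> (c - p) * C * c ^ l"
        using p C0 c0 c1 mN by (intro mult_left_mono power_decreasing) auto
      finally have "S m * R m \<le> (c - p) * C * c ^ l" .
      moreover have "p * R l \<le> p * (C * c ^ l)" using Rl p by (intro mult_left_mono)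
      ultimately show ?thesis using m(2) l by (simp add: algebra_simps)
    qed
  qed
  then show ?thesis by blast
qed

text \<open>Passing from a window index \<open>m\<close> to the new index \<open>k + 1\<close>
  advances by at most \<open>M\<close>, so the exponent in (a) rises by at most one: a single factor
  \<delta> pays for the step.\<close>

lemma window_exponent:
  assumes "M \<ge> 1" "m \<ge> 1" "k + 1 \<le> m + M"
  shows "nat \<lceil>real k / real M\<rceil> \<le> Suc (nat \<lceil>(real m - 1) / real M\<rceil>)"
proof -
  have "real k \<le> (real m - 1) + real M" using assms(3) by linarith
  then have "real k / real M \<le> (real m - 1) / real M + 1"
    using assms(1) by (simp add: field_simps)
  then have "\<lceil>real k / real M\<rceil> \<le> \<lceil>(real m - 1) / real M\<rceil> + 1"
    by linarith
  moreover have "0 \<le> \<lceil>(real m - 1) / real M\<rceil>"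
    using assms(2) by (simp add: less_le_trans[of "-1" 0])
  ultimately show ?thesis by linarith
qed

text \<open>Needed to deduce from (a) that \<open>R\<close> tends to 0.\<close>

lemma window_exponent_at_top:
  assumes "M \<ge> 1"
  shows "filterlim (\<lambda>k. nat \<lceil>(real k - 1) / real M\<rceil>) at_top sequentially"
  unfolding filterlim_at_top
proof
  fix Z :: nat
  have "Z \<le> nat \<lceil>(real k - 1) / real M\<rceil>" if "k \<ge> Z * M + 1" for k
  proof -
    have "real (Z * M + 1) \<le> real k" using that by (simp only: of_nat_le_iff)
    then have "real Z \<le> (real k - 1) / real M" using assms by (simp add: field_simps)
    then show ?thesis by linarith
  qed
  then show "\<forall>\<^sub>F k in sequentially. Z \<le> nat \<lceil>(real k - 1) / real M\<rceil>"
    unfolding eventually_sequentially by blast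
qed

theorem proposition5:
  fixes J M :: nat and p \<delta> :: real and q \<eta> :: "nat \<Rightarrow> real" and R :: "nat \<Rightarrow> real"
  assumes "J \<ge> 1" and "M \<ge> 1"
    and "0 \<le> p" and "p < 1"
    and "\<And>j. j \<in> {1..J} \<Longrightarrow> q j \<ge> 0"
    and "\<And>j. j \<in> {1..J} \<Longrightarrow> \<eta> j > 1"
    and "\<And>k. k \<ge> 1 \<Longrightarrow> R k \<ge> 0"
    and "\<And>k. k \<ge> 1 \<Longrightarrow>
      R (k + 1) \<le> p * R k + (\<Sum>j = 1..J. q j * (MAX k' \<in> {max 1 (k + 1 - M)..k}. R k' powr \<eta> j))"
    and "p \<le> \<delta>" and "\<delta> < 1"
    and "p + (\<Sum>j = 1..J. q j * R 1 powr (\<eta> j - 1)) \<le> \<delta>"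
  shows "(\<forall>k\<ge>1. R k \<le> \<delta> ^ nat \<lceil>(real k - 1) / real M\<rceil> * R 1) \<and>
    (\<exists>Rbar :: nat \<Rightarrow> real.
      (\<forall>k\<ge>1. Rbar k \<ge> R k) \<and> Rbar 1 = R 1 \<and>
      (\<forall>k\<ge>2. Rbar k \<noteq> 0) \<and>
      (\<lambda>k. Rbar (k + 1) / Rbar k) \<longlonglongrightarrow> p)"
proof -
  note M = assms(2) and p = assms(3,4) and q = assms(5) and \<eta> = assms(6) and R0 = assms(7)
    and rec = assms(8) and \<delta> = assms(9-11)
  define S where "S = (\<lambda>m. \<Sum>j = 1..J. q j * R m powr (\<eta> j - 1))"
  \<comment> \<open>By monotonicity of \<open>powr\<close>, one maximiser \<open>m\<close> of
    \<open>R\<close> serves all \<open>j\<close> at once. The clause \<open>R k \<le> R m\<close>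
    later lets \<open>p * R k\<close> be merged with \<open>S m * R m\<close>.\<close>
  have step: "\<exists>m\<in>{max 1 (k + 1 - M)..k}. R k \<le> R m \<and> R (k + 1) \<le> p * R k + S m * R m"
    if k: "k \<ge> 1" for k
  proof -
    let ?W = "{max 1 (k + 1 - M)..k}"
    have W: "finite ?W" "k \<in> ?W" using k M by auto
    have "Max (R ` ?W) \<in> R ` ?W" using W by (intro Max_in) auto
    then obtain m where m: "m \<in> ?W" "R m = Max (R ` ?W)" by auto
    have mx: "R i \<le> R m" if "i \<in> ?W" for i using that m W by auto
    have "q j * (MAX i \<in> ?W. R i powr \<eta> j) \<le> q j * R m powr (\<eta> j - 1) * R m"
      if j: "j \<in> {1..J}" for j
    proof -
      have "(MAX i \<in> ?W. R i powr \<eta> j) \<le> R m powr \<eta> j"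
        using W mx R0 \<eta>[OF j] by (subst Max_le_iff) (auto intro!: powr_mono2)
      also have "\<dots> = R m powr (\<eta> j - 1) * R m"
        using powr_mult_base[of "R m" "\<eta> j - 1"] R0[of m] m(1) by (simp add: mult.commute)
      finally show ?thesis using mult_left_mono[OF _ q[OF j]] by (simp add: mult.assoc)
    qed
    then have "(\<Sum>j = 1..J. q j * (MAX i \<in> ?W. R i powr \<eta> j)) \<le> S m * R m"
      unfolding S_def sum_distrib_right by (intro sum_mono)
    with rec[OF k] m(1) mx[OF W(2)] show ?thesis by (intro bexI[of _ m]) auto
  qed
  have \<delta>0: "\<delta> \<ge> 0" using p \<delta> by linarith
  have a: "R k \<le> \<delta> ^ nat \<lceil>(real k - 1) / real M\<rceil> * R 1" if "k \<ge> 1" for k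
    using that
  proof (induction k rule: less_induct)
    case (less k)
    show ?case
    proof (cases "k = 1")
      case False
      then obtain l where l: "k = l + 1" "l \<ge> 1"
        using less.prems by (cases k) auto
      obtain m where m: "m \<in> {max 1 (l + 1 - M)..l}" "R l \<le> R m"
        "R (l + 1) \<le> p * R l + S m * R m"
        using step[OF l(2)] by blast
      have mb: "m \<ge> 1" "m \<le> l" "l + 1 \<le> m + M" using m(1) by auto
      let ?e = "nat \<lceil>(real m - 1) / real M\<rceil>"
      \<comment> \<open>Besides bounding \<open>R m\<close>, the induction hypothesis yields
        \<open>R m \<le> R 1\<close>, which carries the smallness assumption from \<open>S 1\<close>
        over to \<open>S m\<close>.\<close>
      have IH: "R m \<le> \<delta> ^ ?e * R 1" using less.IH[of m] mb l by auto
      also have "\<dots> \<le> 1 * R 1"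
        using \<delta>0 \<delta> R0[of 1] by (intro mult_right_mono power_le_one) auto
      finally have "R m \<le> R 1" by simp
      then have "S m \<le> S 1"
        unfolding S_def using q \<eta> R0[of m] mb
        by (intro sum_mono mult_left_mono powr_mono2) (auto simp: less_imp_le)
      then have Sm: "p + S m \<le> \<delta>" using \<delta>(3) by (simp add: S_def)
      have "R k \<le> p * R m + S m * R m"
        using m(2,3) p l mult_left_mono[OF m(2), of p] by auto
      also have "\<dots> \<le> \<delta> * R m"
        using mult_right_mono[OF Sm, of "R m"] R0[OF mb(1)] by (simp add: algebra_simps)
      also have "\<dots> \<le> \<delta> ^ Suc ?e * R 1"
        using mult_left_mono[OF IH \<delta>0] by (simp add: mult_ac)
      also have "\<dots> \<le> \<delta> ^ nat \<lceil>real l / real M\<rceil> * R 1"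
        using window_exponent[OF M mb(1,3)] \<delta>0 \<delta> R0[of 1]
        by (intro mult_right_mono power_decreasing) auto
      finally show ?thesis using l by simp
    qed simp
  qed
  have "(\<lambda>k. \<delta> ^ nat \<lceil>(real k - 1) / real M\<rceil>) \<longlonglongrightarrow> 0"
    using filterlim_compose[OF LIMSEQ_power_zero window_exponent_at_top[OF M], of \<delta>] \<delta>0 \<delta> by simp
  then have lim: "(\<lambda>k. \<delta> ^ nat \<lceil>(real k - 1) / real M\<rceil> * R 1) \<longlonglongrightarrow> 0"
    by (rule tendsto_mult_left_zero)
  have Rlim: "R \<longlonglongrightarrow> 0"
    by (rule tendsto_sandwich[OF _ _ tendsto_const lim])
      (use a R0 in \<open>auto simp: eventually_sequentially\<close>)
  have "(\<lambda>m. q j * R m powr (\<eta> j - 1)) \<longlonglongrightarrow> 0" if j: "j \<in> {1..J}" for j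
  proof -
    \<comment> \<open>At base 0 the continuity of \<open>powr\<close> requires a positive exponent,
      which \<open>\<eta> j > 1\<close> supplies; the limit is then 0.\<close>
    have "(\<lambda>m. R m powr (\<eta> j - 1)) \<longlonglongrightarrow> 0 powr (\<eta> j - 1)"
      using \<eta>[OF j] R0 by (intro tendsto_powr' Rlim tendsto_const) (auto simp: eventually_sequentially)
    then show ?thesis by (auto intro: tendsto_mult_right_zero)
  qed
  then have Slim: "S \<longlonglongrightarrow> 0" unfolding S_def by (rule tendsto_null_sum)
  have "\<exists>C. \<forall>k\<ge>1. R k \<le> C * c ^ k" if "p < c" "c < 1" for c
    by (rule window_recursion_geometric[OF p(1) that R0 _ Slim]) (use step in blast)+
  from ratio_limit_majorant[OF p this] obtain g where g: "\<And>k. g k > 0"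
    "\<And>k. k \<ge> 1 \<Longrightarrow> R k \<le> g k" "(\<lambda>k. g (k + 1) / g k) \<longlonglongrightarrow> p"
    by metis
  \<comment> \<open>The reset forces \<open>h 1 = R 1\<close>, possibly 0, and leaves all ratios
    from \<open>k = 2\<close> on unchanged.\<close>
  define h where "h = (\<lambda>k. if k = 1 then R 1 else g k)"
  have "\<forall>\<^sub>F k in sequentially. g (k + 1) / g k = h (k + 1) / h k"
    unfolding eventually_sequentially by (intro exI[of _ 2]) (auto simp: h_def)
  then have "(\<lambda>k. h (k + 1) / h k) \<longlonglongrightarrow> p" using g(3) by (rule Lim_transform_eventually[rotated])
  moreover have "\<forall>k\<ge>1. h k \<ge> R k" "h 1 = R 1" using g(2) by (auto simp: h_def)
  moreover have "h k \<noteq> 0" if "k \<ge> 2" for k using g(1)[of k] that by (simp add: h_def)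
  ultimately show ?thesis using a by blast
qed

end
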